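(* Let $G$ be a connected graph with $n\ge2$ vertices, let $C=\mathrm{cc}(G)$ be its contraction complexity, and let $d\ge2$ and $\chi\ge1$ be integers. Then $$\mathrm{lc}_{d,\chi}(G)\le\min\left\{n,\ 3\max\{1,\lceil C\log_d\chi\rceil\}\right\}\le3\,\Delta(G)\left(\mathrm{tw}(G)+1\right)\max\{1,\lceil\log_d\chi\rceil\},$$ where $\Delta(G)$ is the maximum degree and $\mathrm{tw}(G)$ the treewidth of $G$.
   Context: Graphs are finite, simple, undirected. $\mathrm{cut}_G(S)$ is the set of edges with exactly one endpoint in $S$. Learning sequence for $G=(V,E)$: a finite family $\mathcal L=(S_i,I_i,F_i)_{i=1}^L$ with (1) $S_i\subseteq V$ nonempty, $I_i\subseteq[i-1]$, $F_i\subseteq V$; (2) $S_i=F_i\sqcup\bigsqcup_{j\in I_i}S_j$ (disjoint union); (3) $F_1,\dots,F_L$ pairwise disjoint; (4) the directed graph on $[L]$ with an edge $i\to j$ whenever $j\in I_i$ is a rooted tree with root $L$; (5) $S_L=V$. Put $\bar q_i=\lceil|\mathrm{cut}_G(S_i)|\log_d\chi\rceil$, $\bar a_i=|F_i|+\sum_{j\in I_i}\bar q_j$, $\mathrm{lc}_{d,\chi}(\mathcal L)=\max_{i\in[L]}(\bar a_i+\bar q_i)$, and $\mathrm{lc}_{d,\chi}(G)=\min_{\mathcal L}\mathrm{lc}_{d,\chi}(\mathcal L)$ over all learning sequences for $G$. Contraction complexity: a contraction sequence starts from $G$ and repeatedly chooses a non-loop edge of the current multigraph and identifies its endpoints, until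 every connected component has become a single vertex; parallel edges are retained and counted with multiplicity, loops are deleted. Its complexity is the maximum degree (with multiplicity) of any vertex created by a contraction (degrees of initial vertices are not counted); $\mathrm{cc}(G)$ is the minimum over all contraction sequences. It is known (Markov–Shi) that $\mathrm{cc}(G)\le\Delta(G)(\mathrm{tw}(G)+1)-1$. *)

theory Defs
  imports Complex_Main "HOL-Library.Multiset" "HOL-Library.Disjoint_Sets"
begin

definition simple_graph :: "'a set \<Rightarrow> 'a set set \<Rightarrow> bool" where
  "simple_graph V E \<longleftrightarrow> finite V \<and> (\<forall>e\<in>E. e \<subseteq> V \<and> card e = 2)"

definition edge_rel :: "'a set set \<Rightarrow> ('a \<times> 'a) set" where
  "edge_rel E = {(x, y). {x, y} \<in> E}"

definition graph_connected :: "'a set \<Rightarrow> 'a set set \<Rightarrow> bool" where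
  "graph_connected V E \<longleftrightarrow> V \<noteq> {} \<and> (\<forall>x\<in>V. \<forall>y\<in>V. (x, y) \<in> (edge_rel E)\<^sup>*)"

definition edge_cut :: "'a set set \<Rightarrow> 'a set \<Rightarrow> 'a set set" where
  "edge_cut E S = {e \<in> E. card (e \<inter> S) = 1}"

definition vertex_degree :: "'a set set \<Rightarrow> 'a \<Rightarrow> nat" where
  "vertex_degree E v = card {e \<in> E. v \<in> e}"

definition max_degree :: "'a set \<Rightarrow> 'a set set \<Rightarrow> nat" where
  "max_degree V E = Max (vertex_degree E ` V)"

definition graph_cycle :: "'a set set \<Rightarrow> 'a list \<Rightarrow> bool" where
  "graph_cycle E p \<longleftrightarrow> length p \<ge> 3 \<and> distinct p
     \<and> successively (\<lambda>x y. {x, y} \<in> E) p \<and> {last p, hd p} \<in> E"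

definition graph_tree :: "'a set \<Rightarrow> 'a set set \<Rightarrow> bool" where
  "graph_tree V E \<longleftrightarrow> simple_graph V E \<and> graph_connected V E \<and> (\<nexists>p. graph_cycle E p)"

definition tree_decomposition ::
  "'a set \<Rightarrow> 'a set set \<Rightarrow> 'b set \<Rightarrow> 'b set set \<Rightarrow> ('b \<Rightarrow> 'a set) \<Rightarrow> bool" where
  "tree_decomposition V E N A B \<longleftrightarrow>
     graph_tree N A \<and>
     (\<Union>t\<in>N. B t) = V \<and>
     (\<forall>e\<in>E. \<exists>t\<in>N. e \<subseteq> B t) \<and>
     (\<forall>v\<in>V. graph_connected {t\<in>N. v \<in> B t} {a\<in>A. a \<subseteq> {t\<in>N. v \<in> B t}})"

definition decomposition_width :: "'b set \<Rightarrow> ('b \<Rightarrow> 'a set) \<Rightarrow> nat" where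
  "decomposition_width N B = Max ((\<lambda>t. card (B t)) ` N) - 1"

text \<open>Decomposition trees are finite, so up to isomorphism their nodes are natural numbers.
  For nonempty \<open>V\<close> some bag is nonempty, and the subtraction in the width does not truncate.\<close>

definition treewidth :: "'a set \<Rightarrow> 'a set set \<Rightarrow> nat" where
  "treewidth V E = Inf {decomposition_width N B | (N :: nat set) A B. tree_decomposition V E N A B}"

text \<open>A loopless multigraph: its vertices and a multiset of two-element edges.\<close>

type_synonym 'a multigraph = "'a set \<times> 'a set multiset"

definition multidegree :: "'a multigraph \<Rightarrow> 'a \<Rightarrow> nat" where
  "multidegree H v = size {#e \<in># snd H. v \<in> e#}"

text \<open>Identifies \<open>v\<close> with \<open>u\<close>; the merged vertex is called \<open>u\<close>. Every edge between \<open>u\<close> and \<open>v\<close>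
  becomes the singleton \<open>{u}\<close>, that is, a loop, and is deleted.\<close>

definition contract :: "'a \<Rightarrow> 'a \<Rightarrow> 'a multigraph \<Rightarrow> 'a multigraph" where
  "contract u v H =
     (fst H - {v}, {#e \<in># image_mset (\<lambda>e. id(v := u) ` e) (snd H). card e = 2#})"

fun contraction_sequence :: "'a multigraph \<Rightarrow> ('a \<times> 'a) list \<Rightarrow> bool" where
  "contraction_sequence H [] \<longleftrightarrow>
     (\<forall>x\<in>fst H. \<forall>y\<in>fst H. (x, y) \<in> (edge_rel (set_mset (snd H)))\<^sup>* \<longrightarrow> x = y)"
| "contraction_sequence H ((u, v) # ps) \<longleftrightarrow>
     u \<noteq> v \<and> {u, v} \<in># snd H \<and> contraction_sequence (contract u v H) ps"

text \<open>Only the vertex created by each contraction is counted; the empty sequence, which creates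
  none, has complexity 0.\<close>

fun sequence_complexity :: "'a multigraph \<Rightarrow> ('a \<times> 'a) list \<Rightarrow> nat" where
  "sequence_complexity H [] = 0"
| "sequence_complexity H ((u, v) # ps) =
     max (multidegree (contract u v H) u) (sequence_complexity (contract u v H) ps)"

definition contraction_complexity :: "'a set \<Rightarrow> 'a set set \<Rightarrow> nat" where
  "contraction_complexity V E =
     Inf {sequence_complexity (V, mset_set E) ps | ps. contraction_sequence (V, mset_set E) ps}"

text \<open>A directed graph is a tree rooted at \<open>r\<close> if from \<open>r\<close> there is exactly one directed walk
  to each vertex.\<close>

definition rooted_tree :: "'a set \<Rightarrow> ('a \<times> 'a) set \<Rightarrow> 'a \<Rightarrow> bool" where
  "rooted_tree W A r \<longleftrightarrow> r \<in> W \<and> A \<subseteq> W \<times> W \<and>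
     (\<forall>v\<in>W. \<exists>!p. p \<noteq> [] \<and> hd p = r \<and> last p = v \<and> successively (\<lambda>x y. (x, y) \<in> A) p)"

text \<open>The family \<open>(S\<^sub>i, I\<^sub>i, F\<^sub>i)\<close> is indexed by \<open>{1..L}\<close>; values of the functions outside this
  range are irrelevant.\<close>

definition learning_sequence ::
  "'a set \<Rightarrow> nat \<Rightarrow> (nat \<Rightarrow> 'a set) \<Rightarrow> (nat \<Rightarrow> nat set) \<Rightarrow> (nat \<Rightarrow> 'a set) \<Rightarrow> bool" where
  "learning_sequence V L S I F \<longleftrightarrow>
     (\<forall>i\<in>{1..L}. S i \<subseteq> V \<and> S i \<noteq> {} \<and> I i \<subseteq> {1..<i} \<and> F i \<subseteq> V) \<and>
     (\<forall>i\<in>{1..L}. S i = F i \<union> (\<Union>j\<in>I i. S j)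
        \<and> F i \<inter> (\<Union>j\<in>I i. S j) = {} \<and> disjoint_family_on S (I i)) \<and>
     disjoint_family_on F {1..L} \<and>
     rooted_tree {1..L} {(i, j). i \<in> {1..L} \<and> j \<in> I i} L \<and>
     S L = V"

text \<open>For \<open>d \<ge> 2\<close> and \<open>chi \<ge> 1\<close> the logarithm is nonnegative, so \<open>nat\<close> does not truncate.\<close>

definition q_bar :: "nat \<Rightarrow> nat \<Rightarrow> 'a set set \<Rightarrow> (nat \<Rightarrow> 'a set) \<Rightarrow> nat \<Rightarrow> nat" where
  "q_bar d chi E S i = nat \<lceil>real (card (edge_cut E (S i))) * log (real d) (real chi)\<rceil>"

definition a_bar ::
  "nat \<Rightarrow> nat \<Rightarrow> 'a set set \<Rightarrow> (nat \<Rightarrow> 'a set) \<Rightarrow> (nat \<Rightarrow> nat set) \<Rightarrow> (nat \<Rightarrow> 'a set) \<Rightarrow> nat \<Rightarrow> nat" where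
  "a_bar d chi E S I F i = card (F i) + (\<Sum>j\<in>I i. q_bar d chi E S j)"

definition sequence_lc ::
  "nat \<Rightarrow> nat \<Rightarrow> 'a set set \<Rightarrow> nat \<Rightarrow> (nat \<Rightarrow> 'a set) \<Rightarrow> (nat \<Rightarrow> nat set) \<Rightarrow> (nat \<Rightarrow> 'a set) \<Rightarrow> nat" where
  "sequence_lc d chi E L S I F =
     Max ((\<lambda>i. a_bar d chi E S I F i + q_bar d chi E S i) ` {1..L})"

definition learning_complexity :: "nat \<Rightarrow> nat \<Rightarrow> 'a set \<Rightarrow> 'a set set \<Rightarrow> nat" where
  "learning_complexity d chi V E =
     Inf {sequence_lc d chi E L S I F | L S I F. learning_sequence V L S I F}"

text \<open>\<open>Inf\<close> of a nonempty set of natural numbers is its minimum. The lemmas below show that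
  each of the three sets is nonempty.\<close>

lemma learning_sequence_exists:
  assumes "V \<noteq> {}"
  shows "\<exists>L S I F. learning_sequence V L S I F"
proof -
  have "rooted_tree {1..1::nat} {(i, j). i \<in> {1..1} \<and> j \<in> ({} :: nat set)} 1"
    unfolding rooted_tree_def
  proof (intro conjI ballI)
    fix v :: nat assume "v \<in> {1..1}"
    then have v: "v = 1" by simp
    have "p = [1]" if "p \<noteq> []" "hd p = 1" "successively (\<lambda>x y :: nat. False) p" for p
      using that by (cases p rule: remdups_adj.cases) auto
    then show "\<exists>!p. p \<noteq> [] \<and> hd p = 1 \<and> last p = v
        \<and> successively (\<lambda>x y. (x, y) \<in> {(i, j). i \<in> {1..1} \<and> j \<in> ({} :: nat set)}) p"
      by (intro ex1I[of _ "[1]"]) (auto simp: v)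
  qed auto
  then have "learning_sequence V 1 (\<lambda>_. V) (\<lambda>_. {}) (\<lambda>_. V)"
    using assms by (auto simp: learning_sequence_def disjoint_family_on_def)
  then show ?thesis by blast
qed

lemma tree_decomposition_exists:
  assumes "simple_graph V E"
  shows "\<exists>(N :: nat set) A B. tree_decomposition V E N A B"
proof -
  have "graph_tree {0 :: nat} {}"
    by (auto simp: graph_tree_def simple_graph_def graph_connected_def graph_cycle_def)
  then have "tree_decomposition V E {0 :: nat} {} (\<lambda>_. V)"
    using assms by (auto simp: tree_decomposition_def simple_graph_def graph_connected_def)
  then show ?thesis by blast
qed

lemma contraction_sequence_exists_aux:
  assumes "finite (fst H)" "\<forall>e\<in>#snd H. e \<subseteq> fst H \<and> card e = 2"
  shows "\<exists>ps. contraction_sequence H ps"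
  using assms
proof (induction "card (fst H)" arbitrary: H rule: less_induct)
  case less
  show ?case
  proof (cases "snd H = {#}")
    case True
    then have "contraction_sequence H []" by (auto simp: edge_rel_def)
    then show ?thesis by blast
  next
    case False
    then obtain e where e: "e \<in># snd H" by auto
    with less.prems obtain u v where uv: "e = {u, v}" "u \<noteq> v"
      by (meson card_2_iff)
    have sub: "u \<in> fst H" "v \<in> fst H" using less.prems e uv by auto
    have "card (fst (contract u v H)) < card (fst H)"
      using card_Diff1_less[OF less.prems(1) sub(2)] by (simp add: contract_def)
    moreover have "\<forall>e\<in>#snd (contract u v H). e \<subseteq> fst (contract u v H) \<and> card e = 2"
    proof
      fix e assume "e \<in># snd (contract u v H)"
      then obtain e' where e': "e' \<in># snd H" "e = id(v := u) ` e'" "card e = 2"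
        by (auto simp: contract_def)
      have "id(v := u) ` e' \<subseteq> fst H - {v}"
      proof
        fix x assume "x \<in> id(v := u) ` e'"
        then obtain y where y: "y \<in> e'" "x = (id(v := u)) y" by blast
        have "y \<in> fst H" using e'(1) y(1) less.prems(2) by blast
        then show "x \<in> fst H - {v}" using y(2) sub(1) uv(2) by (cases "y = v") simp_all
      qed
      then show "e \<subseteq> fst (contract u v H) \<and> card e = 2"
        using e' by (simp add: contract_def)
    qed
    ultimately obtain ps where "contraction_sequence (contract u v H) ps"
      using less.hyps[of "contract u v H"] less.prems(1)
      by (metis contract_def finite_Diff fst_conv)
    then have "contraction_sequence H ((u, v) # ps)" using e uv by simp
    then show ?thesis by blast
  qed
qed

lemma contraction_sequence_exists:
  assumes "simple_graph V E"
  shows "\<exists>ps. contraction_sequence (V, mset_set E) ps"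
proof -
  have "E \<subseteq> Pow V" "finite V" using assms by (auto simp: simple_graph_def)
  then have "finite E" using finite_subset by blast
  then show ?thesis
    using assms by (intro contraction_sequence_exists_aux) (auto simp: simple_graph_def)
qed

end

theory Submission
  imports Defs
begin

text \<open>
  The vertex sets merged by an optimal contraction sequence form a laminar family ending in \<open>V\<close>,
  each member being the union of two sets that are singletons or earlier members. Nesting turns
  the family into a learning sequence in which every step has at most two inputs, each costing
  at most \<open>max 1 \<lceil>C log\<^sub>d \<chi>\<rceil>\<close>, and one output with the same bound.

  For the second inequality, root a tree decomposition of minimal width and call the bag nearest
  to the root that contains a vertex its top bag. Repeatedly contract an edge for which the end
  with the top bag nearer to the root is as far from the root as possible. If \<open>v\<close> is that end, all
  vertices merged with \<open>v\<close> have their top bags below that of \<open>v\<close>, and every edge leaving the merged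
  set meets the top bag of \<open>v\<close>; so there are at most \<open>\<Delta> (tw + 1)\<close> such edges.
\<close>

section \<open>Contractions as quotients\<close>

definition fiber :: "'a set \<Rightarrow> ('a \<Rightarrow> 'b) \<Rightarrow> 'b \<Rightarrow> 'a set" where
  "fiber V f x = {y \<in> V. f y = x}"

text \<open>A multigraph reached by contractions is stored as one map \<open>f\<close> from original
  vertices to current names, so every statement about it becomes one about fibers in the original
  graph. The multiset image keeps multiplicities; the filter removes loops.\<close>

definition quotient_graph :: "'a set \<Rightarrow> 'a set set \<Rightarrow> ('a \<Rightarrow> 'a) \<Rightarrow> 'a multigraph" where
  "quotient_graph V E f = (f ` V, {#e \<in># image_mset ((`) f) (mset_set E). card e = 2#})"

lemma simple_graph_finite_edges:
  assumes "simple_graph V E"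
  shows "finite E"
proof -
  have "E \<subseteq> Pow V" "finite V" using assms by (auto simp: simple_graph_def)
  then show ?thesis using finite_subset by blast
qed

lemma simple_graph_edgeD:
  assumes "simple_graph V E" "{x, y} \<in> E"
  shows "x \<in> V" "y \<in> V" "x \<noteq> y"
  using assms by (auto simp: simple_graph_def)

lemma simple_graph_edgeE:
  assumes "simple_graph V E" "e \<in> E"
  obtains x y where "e = {x, y}" "x \<noteq> y" "x \<in> V" "y \<in> V"
  using assms by (force simp: simple_graph_def card_2_iff)

lemma quotient_graph_id:
  assumes "simple_graph V E"
  shows "quotient_graph V E id = (V, mset_set E)"
proof -
  have "{#e \<in># mset_set E. card e = 2#} = {#e \<in># mset_set E. True#}"
    using assms simple_graph_finite_edges[OF assms]
    by (intro filter_mset_cong) (auto simp: simple_graph_def)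
  then show ?thesis by (simp add: quotient_graph_def)
qed

lemma quotient_graph_edge_iff:
  assumes "simple_graph V E"
  shows "{u, v} \<in># snd (quotient_graph V E f) \<and> u \<noteq> v
    \<longleftrightarrow> (\<exists>x y. {x, y} \<in> E \<and> f x = u \<and> f y = v \<and> u \<noteq> v)" (is "?L = ?R")
proof
  assume ?L
  then obtain e where e: "e \<in> E" "f ` e = {u, v}" "u \<noteq> v"
    using simple_graph_finite_edges[OF assms] by (auto simp: quotient_graph_def)
  obtain x y where xy: "e = {x, y}" by (rule simple_graph_edgeE[OF assms e(1)])
  with e consider "f x = u" "f y = v" | "f y = u" "f x = v" by (auto simp: doubleton_eq_iff)
  then show ?R using e xy by cases (blast, metis insert_commute)
next
  assume ?R
  then obtain x y where xy: "{x, y} \<in> E" "{u, v} = f ` {x, y}" "u \<noteq> v" by auto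
  have "{u, v} \<in> (`) f ` E" unfolding xy(2) using xy(1) by (rule imageI)
  moreover have "card {u, v} = 2" using xy(3) by simp
  ultimately show ?L using simple_graph_finite_edges[OF assms] xy(3)
    by (simp add: quotient_graph_def)
qed

text \<open>Loops may be deleted once, at the end: an edge that still has two ends after the
  contraction had two ends before it, since images do not increase cardinality. Contracting in turn
  therefore amounts to composing maps.\<close>

lemma contract_quotient_graph:
  assumes "simple_graph V E" "u \<in> f ` V" "u \<noteq> v"
  shows "contract u v (quotient_graph V E f) = quotient_graph V E (id(v := u) \<circ> f)"
proof -
  let ?h = "id(v := u)"
  have 1: "f ` V - {v} = (?h \<circ> f) ` V"
    using assms(2,3) by (auto simp: image_iff split: if_splits)
  have "card (f ` e) = 2" if "e \<in> E" "card (?h ` f ` e) = 2" for e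
  proof -
    have e: "card e = 2" "finite e" using that assms(1)
      by (auto simp: simple_graph_def intro: card_ge_0_finite)
    show ?thesis
      using card_image_le[OF e(2), of f] card_image_le[of "f ` e" ?h] e that by simp
  qed
  then have "{#e \<in># mset_set E. card (f ` e) = 2 \<and> card (?h ` f ` e) = 2#}
      = {#e \<in># mset_set E. card (?h ` f ` e) = 2#}"
    using simple_graph_finite_edges[OF assms(1)] by (intro filter_mset_cong) auto
  then have "snd (contract u v (quotient_graph V E f)) = snd (quotient_graph V E (?h \<circ> f))"
    unfolding contract_def quotient_graph_def snd_conv filter_mset_image_mset
      multiset.map_comp filter_filter_mset image_comp comp_def by simp
  with 1 show ?thesis
    by (simp add: prod_eq_iff contract_def quotient_graph_def)
qed

lemma card_image_doubleton_iff:
  assumes "x \<noteq> y"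
  shows "card (f ` {x, y}) = 2 \<and> u \<in> f ` {x, y} \<longleftrightarrow> (f x = u) \<noteq> (f y = u)"
  by (auto simp: card_insert_if)

lemma edge_in_cut_iff:
  assumes "x \<noteq> y" "{x, y} \<in> E"
  shows "{x, y} \<in> edge_cut E S \<longleftrightarrow> (x \<in> S) \<noteq> (y \<in> S)"
  using assms by (auto simp: edge_cut_def Int_insert_left)

text \<open>An edge with both ends in the fiber has become a loop, and one with no end there misses
  \<open>u\<close>; the cut remains. This converts degrees of created vertices into the cut sizes
  that enter \<open>q_bar\<close>.\<close>

lemma multidegree_quotient_graph:
  assumes "simple_graph V E"
  shows "multidegree (quotient_graph V E f) u = card (edge_cut E (fiber V f u))"
proof -
  note fin = simple_graph_finite_edges[OF assms]
  have "{e \<in> E. card (f ` e) = 2 \<and> u \<in> f ` e} = edge_cut E (fiber V f u)"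
  proof (rule set_eqI)
    fix e
    show "e \<in> {e \<in> E. card (f ` e) = 2 \<and> u \<in> f ` e} \<longleftrightarrow> e \<in> edge_cut E (fiber V f u)"
    proof (cases "e \<in> E")
      case True
      then obtain x y where "e = {x, y}" "x \<noteq> y" "x \<in> V" "y \<in> V"
        by (rule simple_graph_edgeE[OF assms])
      with True show ?thesis
        using card_image_doubleton_iff[of x y f u] edge_in_cut_iff[of x y E "fiber V f u"]
        by (auto simp: fiber_def)
    qed (auto simp: edge_cut_def)
  qed
  then show ?thesis
    using fin by (simp add: multidegree_def quotient_graph_def filter_mset_image_mset
        filter_filter_mset conj_ac)
qed

lemma fiber_contract:
  assumes "u \<noteq> v"
  shows "fiber V (id(v := u) \<circ> f) x =
    (if x = u then fiber V f u \<union> fiber V f v else if x = v then {} else fiber V f x)"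
  using assms by (auto simp: fiber_def)

lemma connected_invariant_eq:
  assumes "(x, y) \<in> (edge_rel E)\<^sup>*" "\<And>x y. {x, y} \<in> E \<Longrightarrow> f x = f y"
  shows "f x = f y"
  using assms by (induction rule: rtrancl_induct) (auto simp: edge_rel_def)

text \<open>A surviving non-loop edge would connect two different vertices, and without one
  reachability is trivial. So stopping becomes a condition on \<open>f\<close> and the original
  edges.\<close>

lemma contraction_sequence_Nil_quotient:
  assumes "simple_graph V E"
  shows "contraction_sequence (quotient_graph V E f) [] \<longleftrightarrow> (\<forall>x y. {x, y} \<in> E \<longrightarrow> f x = f y)"
proof
  assume L: "contraction_sequence (quotient_graph V E f) []"
  show "\<forall>x y. {x, y} \<in> E \<longrightarrow> f x = f y"
  proof (intro allI impI, rule ccontr)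
    fix x y assume xy: "{x, y} \<in> E" "f x \<noteq> f y"
    then have "(f x, f y) \<in> edge_rel (set_mset (snd (quotient_graph V E f)))"
      using quotient_graph_edge_iff[OF assms, of "f x" "f y" f] by (auto simp: edge_rel_def)
    with L simple_graph_edgeD[OF assms xy(1)] xy show False
      by (auto simp: quotient_graph_def)
  qed
next
  assume R: "\<forall>x y. {x, y} \<in> E \<longrightarrow> f x = f y"
  have "x = y" if "(x, y) \<in> (edge_rel (set_mset (snd (quotient_graph V E f))))\<^sup>*" for x y
  proof (rule connected_invariant_eq[OF that])
    fix x y assume "{x, y} \<in> set_mset (snd (quotient_graph V E f))"
    then show "x = y"
      using quotient_graph_edge_iff[OF assms, of x y f] R by auto
  qed
  then show "contraction_sequence (quotient_graph V E f) []" by simp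
qed

section \<open>Vertex sets merged along a contraction sequence\<close>

text \<open>\<open>T\<close> lists, in order of creation, the vertex sets that the contractions of a
  sequence starting from the quotient by \<open>f\<close> merge into one vertex.\<close>

definition merged_sets ::
  "'a set \<Rightarrow> 'a set set \<Rightarrow> ('a \<Rightarrow> 'a) \<Rightarrow> nat \<Rightarrow> 'a set list \<Rightarrow> bool" where
  "merged_sets V E f k T \<longleftrightarrow>
     (\<forall>A\<in>set T. A \<subseteq> V \<and> A \<noteq> {} \<and> card (edge_cut E A) \<le> k) \<and>
     (\<forall>A\<in>set T. \<forall>x. fiber V f x \<subseteq> A \<or> fiber V f x \<inter> A = {}) \<and>
     (\<forall>i<length T. \<forall>j<i. T ! j \<subseteq> T ! i \<or> T ! j \<inter> T ! i = {}) \<and>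
     (\<forall>i<length T. \<exists>X Y. T ! i = X \<union> Y \<and> X \<noteq> {} \<and> Y \<noteq> {}
        \<and> {X, Y} \<subseteq> range (fiber V f) \<union> (!) T ` {..<i}) \<and>
     (T \<noteq> [] \<longrightarrow> last T = V)"

lemma merged_setsD:
  assumes "merged_sets V E f k T"
  shows "A \<in> set T \<Longrightarrow> A \<subseteq> V \<and> A \<noteq> {} \<and> card (edge_cut E A) \<le> k"
    and "A \<in> set T \<Longrightarrow> fiber V f x \<subseteq> A \<or> fiber V f x \<inter> A = {}"
    and "\<lbrakk>i < length T; j < i\<rbrakk> \<Longrightarrow> T ! j \<subseteq> T ! i \<or> T ! j \<inter> T ! i = {}"
    and "i < length T \<Longrightarrow> \<exists>X Y. T ! i = X \<union> Y \<and> X \<noteq> {} \<and> Y \<noteq> {}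
      \<and> {X, Y} \<subseteq> range (fiber V f) \<union> (!) T ` {..<i}"
    and "T \<noteq> [] \<Longrightarrow> last T = V"
  using assms unfolding merged_sets_def by simp_all

text \<open>The map \<open>f\<close> is kept general because after one contraction the rest of the
  sequence starts from a coarser quotient. The induction puts the first merged set in front of the
  list obtained for that quotient.\<close>

lemma contraction_sequence_merged_sets:
  assumes G: "simple_graph V E" "graph_connected V E"
    and "contraction_sequence (quotient_graph V E f) ps"
  shows "\<exists>T. length T = length ps
    \<and> merged_sets V E f (sequence_complexity (quotient_graph V E f) ps) T"
  using assms(3)
proof (induction ps arbitrary: f)
  case Nil
  then show ?case by (intro exI[of _ "[]"]) (simp add: merged_sets_def)
next
  case (Cons p ps)
  obtain u v where p: "p = (u, v)" by force
  define g where "g = id(v := u) \<circ> f"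
  from Cons.prems p have uv: "u \<noteq> v" "{u, v} \<in># snd (quotient_graph V E f)" by auto
  then obtain x y where xy: "{x, y} \<in> E" "f x = u" "f y = v"
    using quotient_graph_edge_iff[OF G(1), of u v f] by auto
  note xyV = simple_graph_edgeD[OF G(1) xy(1)]
  have con: "contract u v (quotient_graph V E f) = quotient_graph V E g"
    unfolding g_def using xy xyV uv by (intro contract_quotient_graph[OF G(1)]) auto
  have seq: "contraction_sequence (quotient_graph V E g) ps"
    using Cons.prems con by (simp add: p)
  define A where "A = fiber V g u"
  have A: "A = fiber V f u \<union> fiber V f v" "fiber V f u \<noteq> {}" "fiber V f v \<noteq> {}"
    using xy xyV uv by (auto simp: A_def g_def fiber_def)
  \<comment> \<open>The only new fiber is \<open>A\<close>. Hence a nonempty fiber of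
    \<open>g\<close> used as a part of a later set is a fiber of \<open>f\<close> or the new first
    list entry.\<close>
  have gf: "fiber V g z = A \<or> fiber V g z = {} \<or> fiber V g z = fiber V f z" for z
    using fiber_contract[OF uv(1), of V f z] by (auto simp: A g_def)
  \<comment> \<open>Fibers of \<open>f\<close> refine those of \<open>g\<close>, so a set that cuts
    no fiber of \<open>g\<close> cuts no fiber of \<open>f\<close>.\<close>
  have fg: "fiber V f z \<subseteq> fiber V g ((id(v := u)) z)" for z
    by (auto simp: fiber_def g_def)
  have compl: "sequence_complexity (quotient_graph V E f) (p # ps) =
      max (card (edge_cut E A)) (sequence_complexity (quotient_graph V E g) ps)"
    by (simp add: p con multidegree_quotient_graph[OF G(1)] A_def)
  from Cons.IH[OF seq] obtain T where lenT: "length T = length ps"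
    and T: "merged_sets V E g (sequence_complexity (quotient_graph V E g) ps) T"
    by blast
  note T = merged_setsD[OF T]
  have 1: "B \<subseteq> V \<and> B \<noteq> {} \<and> card (edge_cut E B) \<le> sequence_complexity (quotient_graph V E f) (p # ps)
      \<and> (\<forall>x. fiber V f x \<subseteq> B \<or> fiber V f x \<inter> B = {})" if "B \<in> set (A # T)" for B
  proof -
    have "fiber V f x \<subseteq> B \<or> fiber V f x \<inter> B = {}" for x
    proof (cases "B = A")
      case True
      then show ?thesis by (auto simp: A fiber_def)
    next
      case False
      then show ?thesis using T(2)[of B "(id(v := u)) x"] fg[of x] that by auto
    qed
    then show ?thesis using that T(1)[of B] compl A by (auto simp: fiber_def)
  qed
  have 2: "(A # T) ! j \<subseteq> (A # T) ! i \<or> (A # T) ! j \<inter> (A # T) ! i = {}"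
    if ij: "i < length (A # T)" "j < i" for i j
  proof (cases j)
    case 0
    then show ?thesis using ij T(2)[of "T ! (i - 1)" u] by (auto simp: A_def)
  next
    case (Suc k)
    then show ?thesis using ij T(3)[of "i - 1" k] by auto
  qed
  have 3: "\<exists>X Y. (A # T) ! i = X \<union> Y \<and> X \<noteq> {} \<and> Y \<noteq> {}
      \<and> {X, Y} \<subseteq> range (fiber V f) \<union> (!) (A # T) ` {..<i}" if i: "i < length (A # T)" for i
  proof (cases i)
    case 0
    then show ?thesis using A by auto
  next
    case (Suc k)
    then obtain X Y where XY: "T ! k = X \<union> Y" "X \<noteq> {}" "Y \<noteq> {}"
      "{X, Y} \<subseteq> range (fiber V g) \<union> (!) T ` {..<k}"
      using T(4)[of k] i by auto
    have "Z \<in> range (fiber V f) \<union> (!) (A # T) ` {..<i}"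
      if Z: "Z \<in> range (fiber V g) \<union> (!) T ` {..<k}" "Z \<noteq> {}" for Z
    proof (cases "Z \<in> range (fiber V g)")
      case True
      then have "Z = A \<or> Z \<in> range (fiber V f)" using gf Z(2) by blast
      moreover have "A \<in> (!) (A # T) ` {..<i}" using Suc by force
      ultimately show ?thesis by blast
    next
      case False
      then obtain l where "l < k" "Z = T ! l" using Z by auto
      then have "Z = (A # T) ! Suc l" "Suc l < i" using Suc by auto
      then show ?thesis by blast
    qed
    then have "{X, Y} \<subseteq> range (fiber V f) \<union> (!) (A # T) ` {..<i}"
      using XY by auto
    with XY Suc show ?thesis by (intro exI[of _ X] exI[of _ Y]) simp
  qed
  have 4: "last (A # T) = V"
  proof (cases "T = []")
    \<comment> \<open>With no contraction left, \<open>g\<close> is constant along edges and thus,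
      by connectedness, on all of \<open>V\<close>; so \<open>A\<close> is \<open>V\<close>.\<close>
    case True
    then have "ps = []" using lenT by simp
    then have "\<And>x y. {x, y} \<in> E \<Longrightarrow> g x = g y"
      using seq contraction_sequence_Nil_quotient[OF G(1)] by blast
    then have "g a = g b" if "a \<in> V" "b \<in> V" for a b
      using connected_invariant_eq[of a b E g] that G(2) unfolding graph_connected_def by blast
    moreover have "g x = u" using xy uv by (simp add: g_def)
    ultimately have "g a = u" if "a \<in> V" for a using that xyV(1) by metis
    then show ?thesis using True by (auto simp: A_def fiber_def)
  qed (use T(5) in auto)
  have "merged_sets V E f (sequence_complexity (quotient_graph V E f) (p # ps)) (A # T)"
    unfolding merged_sets_def
    by (intro conjI ballI allI impI) (use 1 in simp, use 1 in simp, use 1 in simp, use 1 in simp,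
        rule 2, assumption+, rule 3, assumption, rule 4)
  then show ?case using lenT by (intro exI[of _ "A # T"]) simp
qed

section \<open>Learning sequences from laminar families\<close>

text \<open>Parents have larger indices, so induction on \<open>L - v\<close> applies: a walk to
  \<open>v\<close> is the unique walk to its parent followed by \<open>v\<close>. The root has only
  the trivial walk because an edge into \<open>L\<close> would start above \<open>L\<close>.\<close>

lemma rooted_tree_of_unique_parent:
  fixes I :: "nat \<Rightarrow> nat set"
  assumes L: "1 \<le> L"
    and I: "\<And>i. i \<in> {1..L} \<Longrightarrow> I i \<subseteq> {1..<i}"
    and ex: "\<And>j. j \<in> {1..<L} \<Longrightarrow> \<exists>i\<in>{1..L}. j \<in> I i"
    and uniq: "\<And>i i' j. \<lbrakk>i \<in> {1..L}; i' \<in> {1..L}; j \<in> I i; j \<in> I i'\<rbrakk> \<Longrightarrow> i = i'"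
  shows "rooted_tree {1..L} {(i, j). i \<in> {1..L} \<and> j \<in> I i} L"
proof -
  define A where "A = {(i, j). i \<in> {1..L} \<and> j \<in> I i}"
  have A: "i \<in> {1..L} \<and> j \<in> {1..<i}" if "(i, j) \<in> A" for i j
    using that I unfolding A_def by blast
  define walk where
    "walk v p \<longleftrightarrow> p \<noteq> [] \<and> hd p = L \<and> last p = v \<and> successively (\<lambda>x y. (x, y) \<in> A) p" for v p
  have walk_snoc: "walk v (p @ [v]) \<longleftrightarrow> (if p = [] then v = L else walk (last p) p \<and> (last p, v) \<in> A)"
    for v p by (auto simp: walk_def successively_append_iff hd_append)
  have le: "v \<le> L" if "walk v p" for v p
    using that
  proof (cases p rule: rev_cases)
    case (snoc q w)
    then have "w = v" using that by (simp add: walk_def)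
    then show ?thesis using that snoc walk_snoc[of v q] A[of "last q" v] by (auto split: if_splits)
  qed (simp add: walk_def)
  have "v \<in> {1..L} \<Longrightarrow> \<exists>!p. walk v p" for v
  proof (induction "L - v" arbitrary: v rule: less_induct)
    case less
    show ?case
    proof (cases "v = L")
      case True
      have "p = [L]" if "walk L p" for p
      proof (cases p rule: rev_cases)
        case (snoc q w)
        then have "w = L" using that by (simp add: walk_def)
        with snoc that have "walk L (q @ [L])" by simp
        then have "q = []" using le[of "last q" q] A[of "last q" L] walk_snoc[of L q]
          by (fastforce split: if_splits)
        then show ?thesis using snoc \<open>w = L\<close> by simp
      qed (use that in \<open>simp add: walk_def\<close>)
      then show ?thesis using True by (intro ex1I[of _ "[L]"]) (auto simp: walk_def)
    next
      case False
      then obtain i where i: "i \<in> {1..L}" "v \<in> I i" using ex[of v] less.prems by auto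
      then have "v < i" using I[of i] by auto
      then have "\<exists>!q. walk i q" using less.hyps[of i] i by auto
      then obtain q where q: "walk i q" "\<And>q'. walk i q' \<Longrightarrow> q' = q" by blast
      have "walk v (q @ [v])"
        using q(1) i by (simp add: walk_snoc A_def) (simp add: walk_def)
      moreover have "p = q @ [v]" if "walk v p" for p
      proof (cases p rule: rev_cases)
        case (snoc q' w)
        then have "w = v" using that by (simp add: walk_def)
        with that snoc have *: "walk (last q') q'" "(last q', v) \<in> A"
          using walk_snoc[of v q'] False by (auto split: if_splits)
        then have "last q' = i" using i uniq[of "last q'" i v] by (auto simp: A_def)
        then show ?thesis using * q(2) snoc \<open>w = v\<close> by simp
      qed (use that in \<open>simp add: walk_def\<close>)
      ultimately show ?thesis by blast
    qed
  qed
  moreover have "A \<subseteq> {1..L} \<times> {1..L}" using A by fastforce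
  ultimately show ?thesis using L unfolding rooted_tree_def A_def[symmetric] walk_def by simp
qed

text \<open>The parent of \<open>j\<close> is the least later index \<open>i\<close> with \<open>S j \<subseteq> S i\<close>.\<close>

definition laminar_children :: "(nat \<Rightarrow> 'a set) \<Rightarrow> nat \<Rightarrow> nat set" where
  "laminar_children S i = {j \<in> {1..<i}. S j \<subseteq> S i \<and> (\<forall>k\<in>{j<..<i}. \<not> S j \<subseteq> S k)}"

definition laminar_rest :: "(nat \<Rightarrow> 'a set) \<Rightarrow> nat \<Rightarrow> 'a set" where
  "laminar_rest S i = S i - (\<Union>j\<in>laminar_children S i. S j)"

text \<open>Laminarity is one-sided: when two sets meet, the earlier lies in the later. This fits
  sets that only grow by merging.\<close>

locale laminar_sequence =
  fixes V :: "'a set" and L :: nat and S :: "nat \<Rightarrow> 'a set"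
  assumes L: "1 \<le> L" and SL: "S L = V"
    and S: "\<And>i. i \<in> {1..L} \<Longrightarrow> S i \<subseteq> V \<and> S i \<noteq> {}"
    and laminar: "\<And>i j. \<lbrakk>i \<in> {1..L}; j \<in> {1..<i}\<rbrakk> \<Longrightarrow> S j \<subseteq> S i \<or> S j \<inter> S i = {}"
begin

text \<open>Among the sets before \<open>i\<close> containing \<open>S j\<close>, the one with the
  largest index is a child: it meets \<open>S i\<close> in the nonempty \<open>S j\<close>, so
  laminarity puts it inside \<open>S i\<close>, and a superset of it at an index in between would
  contradict maximality.\<close>

lemma laminar_children_cover:
  assumes "i \<in> {1..L}" "j \<in> {1..<i}" "S j \<subseteq> S i"
  shows "\<exists>k\<in>laminar_children S i. S j \<subseteq> S k"
proof -
  define k where "k = (GREATEST k. k < i \<and> S j \<subseteq> S k)"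
  have k: "k < i \<and> S j \<subseteq> S k"
    unfolding k_def by (rule GreatestI_nat[where b = i and k = j]) (use assms in auto)
  have le: "l \<le> k" if "l < i" "S j \<subseteq> S l" for l
    unfolding k_def by (rule Greatest_le_nat[where b = i]) (use that in auto)
  have "j \<le> k" using le[of j] assms by simp
  have kL: "k \<in> {1..L}" "k \<in> {1..<i}" using k \<open>j \<le> k\<close> assms by auto
  have "S k \<subseteq> S i" using laminar[OF assms(1) kL(2)] k S[of j] assms by auto
  moreover have "\<not> S k \<subseteq> S l" if "l \<in> {k<..<i}" for l
    using le[of l] that k by auto
  ultimately show ?thesis using k kL unfolding laminar_children_def by blast
qed

text \<open>If children \<open>j < k\<close> of \<open>i\<close> met, \<open>S j\<close> would lie
  in \<open>S k\<close>, and its first later superset would come before \<open>i\<close>.\<close>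

lemma disjoint_laminar_children:
  assumes "i \<in> {1..L}"
  shows "disjoint_family_on S (laminar_children S i)"
proof -
  have "S j \<inter> S k = {}" if "j \<in> laminar_children S i" "k \<in> laminar_children S i" "j < k" for j k
    using laminar[of k j] that assms by (auto simp: laminar_children_def)
  then show ?thesis unfolding disjoint_family_on_def
    by (metis Int_commute linorder_neqE_nat)
qed

lemma laminar_learning_sequence:
  "learning_sequence V L S (laminar_children S) (laminar_rest S)"
proof -
  have "rooted_tree {1..L} {(i, j). i \<in> {1..L} \<and> j \<in> laminar_children S i} L"
  proof (rule rooted_tree_of_unique_parent[OF L])
    fix j assume j: "j \<in> {1..<L}"
    define i where "i = (LEAST i. j < i \<and> S j \<subseteq> S i)"
    \<comment> \<open>Since \<open>S L = V\<close> contains every set, a first later superset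
      exists.\<close>
    have ex: "j < L \<and> S j \<subseteq> S L" using j S[of j] SL by auto
    have i: "j < i \<and> S j \<subseteq> S i" unfolding i_def using ex by (rule LeastI)
    have iL: "i \<le> L" unfolding i_def using ex by (rule Least_le)
    have "\<not> S j \<subseteq> S k" if "k \<in> {j<..<i}" for k
      using not_less_Least[of k "\<lambda>i. j < i \<and> S j \<subseteq> S i"] that by (auto simp: i_def)
    then show "\<exists>i\<in>{1..L}. j \<in> laminar_children S i"
      using i iL j by (intro bexI[of _ i]) (auto simp: laminar_children_def)
  next
    fix i i' j assume *: "i \<in> {1..L}" "i' \<in> {1..L}" "j \<in> laminar_children S i" "j \<in> laminar_children S i'"
    then have "\<not> i < i'" "\<not> i' < i" by (auto simp: laminar_children_def)
    then show "i = i'" by simp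
  qed (auto simp: laminar_children_def)
  moreover have "laminar_rest S i \<inter> laminar_rest S j = {}"
    if ij: "i \<in> {1..L}" "j \<in> {1..L}" "i < j" for i j
  proof (cases "S i \<subseteq> S j")
    \<comment> \<open>Nested sets: \<open>S i\<close> lies in a child of \<open>j\<close>, which is
      removed from the rest of \<open>j\<close>.\<close>
    case True
    then obtain k where "k \<in> laminar_children S j" "S i \<subseteq> S k"
      using laminar_children_cover[of j i] ij by auto
    then show ?thesis by (auto simp: laminar_rest_def)
  next
    case False
    then have "S i \<inter> S j = {}" using laminar[of j i] ij by auto
    then show ?thesis by (auto simp: laminar_rest_def)
  qed
  then have "disjoint_family_on (laminar_rest S) {1..L}"
    unfolding disjoint_family_on_def by (metis Int_commute linorder_neqE_nat)
  moreover have "S i = laminar_rest S i \<union> (\<Union>j\<in>laminar_children S i. S j)" for i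
    by (auto simp: laminar_rest_def laminar_children_def)
  moreover have "laminar_rest S i \<inter> (\<Union>j\<in>laminar_children S i. S j) = {}" for i
    by (auto simp: laminar_rest_def)
  moreover have "laminar_children S i \<subseteq> {1..<i}" for i
    by (auto simp: laminar_children_def)
  moreover have "laminar_rest S i \<subseteq> V" if "i \<in> {1..L}" for i
    using S[OF that] by (auto simp: laminar_rest_def)
  ultimately show ?thesis
    unfolding learning_sequence_def using S SL disjoint_laminar_children
    by (intro conjI ballI) metis+
qed

text \<open>Fix one point in each part. The children and the single points of the rest are pairwise
  disjoint, and each contains one of the two chosen points.\<close>

lemma laminar_parts_le_2:
  assumes i: "i \<in> {1..L}" and XY: "S i = X \<union> Y" "X \<noteq> {}" "Y \<noteq> {}"
    and parts: "\<And>Z. Z \<in> {X, Y} \<Longrightarrow> (\<exists>z. Z = {z}) \<or> Z \<in> S ` {1..<i}"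
  shows "card (laminar_rest S i) + card (laminar_children S i) \<le> 2"
proof -
  obtain x y where xy: "x \<in> X" "y \<in> Y" using XY by blast
  have sub: "Z \<subseteq> S i" if "Z \<in> {X, Y}" for Z using that XY by auto
  have rest: "laminar_rest S i \<subseteq> {x, y}"
  proof
    fix a assume a: "a \<in> laminar_rest S i"
    then obtain Z where Z: "Z \<in> {X, Y}" "a \<in> Z" using XY by (auto simp: laminar_rest_def)
    \<comment> \<open>A part that is an earlier set lies inside a child and contributes nothing to
      the rest. So the part containing \<open>a\<close> is a singleton, and its chosen point is
      \<open>a\<close>.\<close>
    have "Z \<notin> S ` {1..<i}"
    proof
      assume "Z \<in> S ` {1..<i}"
      then obtain j where "j \<in> {1..<i}" "Z = S j" by auto
      then obtain k where "k \<in> laminar_children S i" "Z \<subseteq> S k"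
        using laminar_children_cover[OF i, of j] sub[OF Z(1)] by auto
      with a Z show False by (auto simp: laminar_rest_def)
    qed
    then have "Z = {a}" using parts[OF Z(1)] Z(2) by auto
    then show "a \<in> {x, y}" using Z xy by auto
  qed
  have child: "S k \<inter> {x, y} \<noteq> {}" if k: "k \<in> laminar_children S i" for k
  proof -
    have k': "k \<in> {1..<i}" "S k \<subseteq> S i" "S k \<noteq> {}"
      using k i S[of k] by (auto simp: laminar_children_def)
    then obtain z where z: "z \<in> S k" "z \<in> X \<union> Y" unfolding XY(1) by auto
    then obtain Z where Z: "Z \<in> {X, Y}" "S k \<inter> Z \<noteq> {}" by auto
    \<comment> \<open>A child meeting a part contains it. Otherwise the part would be some
      \<open>S j\<close> with \<open>k < j < i\<close> containing \<open>S k\<close>, and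
      \<open>i\<close> would not be the first later superset of \<open>S k\<close>.\<close>
    have "Z \<subseteq> S k"
    proof (cases "\<exists>z. Z = {z}")
      case True
      then show ?thesis using Z by auto
    next
      case False
      then obtain j where j: "j \<in> {1..<i}" "Z = S j" using parts[OF Z(1)] by auto
      consider "j = k" | "j < k" | "k < j" by linarith
      then show ?thesis
      proof cases
        case 2
        then show ?thesis using laminar[of k j] j k' i Z by auto
      next
        case 3
        then have "S k \<subseteq> S j" using laminar[of j k] j k' i Z by auto
        then show ?thesis using k j 3 by (auto simp: laminar_children_def)
      qed (simp add: j)
    qed
    then show ?thesis using Z(1) xy by auto
  qed
  have fin: "finite (laminar_children S i)" "finite (laminar_rest S i)"
    using finite_subset[OF rest] by (auto simp: laminar_children_def)
  have "card (laminar_children S i) = (\<Sum>k\<in>laminar_children S i. 1)" by simp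
  also have "\<dots> \<le> (\<Sum>k\<in>laminar_children S i. card (S k \<inter> {x, y}))"
    using child by (intro sum_mono) (simp add: Suc_le_eq card_gt_0_iff)
  also have "\<dots> = card (\<Union>k\<in>laminar_children S i. S k \<inter> {x, y})"
    using disjoint_laminar_children[OF i] fin
    by (intro card_UN_disjoint[symmetric]) (auto simp: disjoint_family_on_def)
  finally have "card (laminar_rest S i) + card (laminar_children S i)
      \<le> card (laminar_rest S i) + card (\<Union>k\<in>laminar_children S i. S k \<inter> {x, y})" by simp
  also have "\<dots> = card (laminar_rest S i \<union> (\<Union>k\<in>laminar_children S i. S k \<inter> {x, y}))"
    using fin by (intro card_Un_disjoint[symmetric]) (auto simp: laminar_rest_def)
  also have "\<dots> \<le> card {x, y}" using rest by (intro card_mono) auto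
  also have "\<dots> \<le> 2" by (simp add: card_insert_if)
  finally show ?thesis .
qed

end

section \<open>Upper bounds on the learning complexity\<close>

lemma learning_complexity_le:
  "learning_sequence V L S I F \<Longrightarrow> learning_complexity d chi V E \<le> sequence_lc d chi E L S I F"
  unfolding learning_complexity_def by (rule cInf_lower) auto

text \<open>A single step that takes all vertices as fresh has an empty cut.\<close>

lemma learning_complexity_le_card:
  assumes "V \<noteq> {}" "simple_graph V E"
  shows "learning_complexity d chi V E \<le> card V"
proof -
  have c: "laminar_children (\<lambda>_. V) i = {}" if "i \<le> 1" for i
    using that by (auto simp: laminar_children_def)
  interpret lam: laminar_sequence V 1 "\<lambda>_. V"
    using assms(1) by unfold_locales auto
  have "edge_cut E V = {}"
    using assms(2) by (auto simp: edge_cut_def simple_graph_def Int_absorb2)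
  then have "sequence_lc d chi E 1 (\<lambda>_. V) (laminar_children (\<lambda>_. V)) (laminar_rest (\<lambda>_. V)) = card V"
    by (simp add: sequence_lc_def a_bar_def q_bar_def laminar_rest_def c)
  then show ?thesis using learning_complexity_le[OF lam.laminar_learning_sequence] by metis
qed

lemma sequence_complexity_attains_contraction_complexity:
  assumes "simple_graph V E"
  obtains ps where "contraction_sequence (V, mset_set E) ps"
    "sequence_complexity (V, mset_set E) ps = contraction_complexity V E"
proof -
  let ?A = "{sequence_complexity (V, mset_set E) ps | ps. contraction_sequence (V, mset_set E) ps}"
  have "?A \<noteq> {}" using contraction_sequence_exists[OF assms] by auto
  then have "Inf ?A \<in> ?A" by (rule Inf_nat_def1)
  then show ?thesis using that by (auto simp: contraction_complexity_def)
qed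

lemma learning_complexity_le_contraction_complexity:
  assumes G: "simple_graph V E" "graph_connected V E" and "2 \<le> card V" and d: "2 \<le> d" and chi: "1 \<le> chi"
  shows "learning_complexity d chi V E
    \<le> 3 * max 1 (nat \<lceil>real (contraction_complexity V E) * log (real d) (real chi)\<rceil>)"
proof -
  obtain ps where "contraction_sequence (V, mset_set E) ps"
    "sequence_complexity (V, mset_set E) ps = contraction_complexity V E"
    by (rule sequence_complexity_attains_contraction_complexity[OF G(1)])
  note ps = this[folded quotient_graph_id[OF G(1)]]
  define k where "k = contraction_complexity V E"
  \<comment> \<open>The 1 in the maximum pays for a fresh vertex, which costs 1 even when the
    logarithm vanishes. So \<open>K\<close> bounds each input of a step, be it a vertex or an
    earlier set, as well as its output.\<close>
  define K where "K = max 1 (nat \<lceil>real k * log (real d) (real chi)\<rceil>)"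
  obtain T where len: "length T = length ps" and T: "merged_sets V E id k T"
    using contraction_sequence_merged_sets[OF G ps(1)] unfolding ps(2) k_def[symmetric] by blast
  \<comment> \<open>A connected graph with two or more vertices requires a contraction, so the
    family is nonempty.\<close>
  have "ps \<noteq> []"
  proof
    assume "ps = []"
    then have "\<And>x y. {x, y} \<in> E \<Longrightarrow> id x = id y"
      using ps(1) contraction_sequence_Nil_quotient[OF G(1)] by blast
    then have "x = y" if "x \<in> V" "y \<in> V" for x y
      using connected_invariant_eq[of x y E id] that G(2) by (auto simp: graph_connected_def)
    then have "card V \<le> 1"
      using G(1) card_le_Suc0_iff_eq[of V] by (auto simp: simple_graph_def)
    then show False using assms(3) by simp
  qed
  define L where "L = length T"
  \<comment> \<open>Lists count from 0, learning sequences from 1.\<close>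
  define S where "S i = T ! (i - 1)" for i
  have TS: "S i \<in> set T" if "i \<in> {1..L}" for i
    using that by (auto simp: S_def L_def)
  have L: "1 \<le> L" using \<open>ps \<noteq> []\<close> len by (simp add: L_def Suc_le_eq)
  then have SL: "S L = V"
    using T by (auto simp: merged_sets_def S_def L_def last_conv_nth)
  have S: "S i \<subseteq> V \<and> S i \<noteq> {}" "card (edge_cut E (S i)) \<le> k" if "i \<in> {1..L}" for i
    using TS[OF that] T by (auto simp: merged_sets_def)
  have laminar: "S j \<subseteq> S i \<or> S j \<inter> S i = {}" if "i \<in> {1..L}" "j \<in> {1..<i}" for i j
  proof -
    have "i - 1 < length T" "j - 1 < i - 1" using that by (auto simp: L_def)
    then show ?thesis unfolding S_def by (rule merged_setsD(3)[OF T])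
  qed
  let ?I = "laminar_children S" and ?F = "laminar_rest S"
  interpret lam: laminar_sequence V L S
    using L SL S(1) laminar by unfold_locales
  have "learning_complexity d chi V E \<le> sequence_lc d chi E L S ?I ?F"
    by (rule learning_complexity_le[OF lam.laminar_learning_sequence])
  also have "\<dots> \<le> 3 * K"
    unfolding sequence_lc_def
  proof (rule Max.boundedI)
    have log: "0 \<le> log (real d) (real chi)" using d chi by simp
    have q: "q_bar d chi E S i \<le> K" if "i \<in> {1..L}" for i
    proof -
      have "real (card (edge_cut E (S i))) * log (real d) (real chi) \<le> real k * log (real d) (real chi)"
        using S(2)[OF that] log by (intro mult_right_mono) auto
      then show ?thesis unfolding q_bar_def K_def
        by (meson ceiling_mono max.coboundedI2 nat_mono)
    qed
    fix a assume "a \<in> (\<lambda>i. a_bar d chi E S ?I ?F i + q_bar d chi E S i) ` {1..L}"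
    then obtain i where i: "i \<in> {1..L}" and a: "a = a_bar d chi E S ?I ?F i + q_bar d chi E S i"
      by auto
    have "card (?F i) + card (?I i) \<le> 2"
    proof -
      have "i - 1 < length T" using i by (auto simp: L_def)
      then obtain X Y where XY: "S i = X \<union> Y" "X \<noteq> {}" "Y \<noteq> {}"
        "{X, Y} \<subseteq> range (fiber V id) \<union> (!) T ` {..<i - 1}"
        unfolding S_def using merged_setsD(4)[OF T] by meson
      have "(\<exists>z. Z = {z}) \<or> Z \<in> S ` {1..<i}" if Z: "Z \<in> {X, Y}" for Z
      proof (cases "Z \<in> range (fiber V id)")
        case True
        moreover have "Z \<noteq> {}" using Z XY by auto
        moreover have "fiber V id z \<subseteq> {z}" for z by (auto simp: fiber_def)
        ultimately show ?thesis by (metis imageE subset_singletonD)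
      next
        case False
        then obtain j where "j < i - 1" "Z = T ! j" using XY Z by blast
        then have "Suc j \<in> {1..<i}" "Z = S (Suc j)" by (auto simp: S_def)
        then show ?thesis by blast
      qed
      then show ?thesis
        by (intro lam.laminar_parts_le_2[OF i XY(1-3)])
    qed
    moreover have "(\<Sum>j\<in>?I i. q_bar d chi E S j) \<le> (\<Sum>j\<in>?I i. K)"
      using i by (intro sum_mono q) (auto simp: laminar_children_def)
    then have "(\<Sum>j\<in>?I i. q_bar d chi E S j) \<le> card (?I i) * K" by simp
    moreover have "card (?F i) \<le> card (?F i) * K" by (simp add: K_def)
    ultimately have "a_bar d chi E S ?I ?F i \<le> (card (?F i) + card (?I i)) * K"
      unfolding a_bar_def add_mult_distrib by linarith
    also have "\<dots> \<le> 2 * K" using \<open>card (?F i) + card (?I i) \<le> 2\<close> by (rule mult_le_mono1)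
    finally show "a \<le> 3 * K" using q[OF i] by (simp add: a)
  qed (use L in auto)
  finally show ?thesis unfolding K_def k_def .
qed

section \<open>Contraction complexity and treewidth\<close>

text \<open>As in Kruskal's algorithm for a maximum spanning tree, with the weight of an edge being the
  minimum of the weights of its ends.\<close>

lemma greedy_contraction_sequence:
  fixes w :: "'a \<Rightarrow> nat"
  assumes G: "simple_graph V E"
    and bound: "\<And>X m. \<lbrakk>X \<subseteq> V; \<exists>v\<in>X. w v = m;
        \<And>x y. \<lbrakk>x \<in> X; y \<in> X\<rbrakk> \<Longrightarrow> (x, y) \<in> (edge_rel {e \<in> E. \<forall>z\<in>e. m \<le> w z})\<^sup>*;
        \<And>e. e \<in> edge_cut E X \<Longrightarrow> \<exists>z\<in>e. w z \<le> m\<rbrakk> \<Longrightarrow> card (edge_cut E X) \<le> K"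
    and "\<And>x y. \<lbrakk>{x, y} \<in> E; f x \<noteq> f y\<rbrakk> \<Longrightarrow> min (w x) (w y) \<le> m"
    and "\<And>x y. \<lbrakk>x \<in> V; y \<in> V; f x = f y\<rbrakk> \<Longrightarrow> (x, y) \<in> (edge_rel {e \<in> E. \<forall>z\<in>e. m \<le> w z})\<^sup>*"
  shows "\<exists>ps. contraction_sequence (quotient_graph V E f) ps
    \<and> sequence_complexity (quotient_graph V E f) ps \<le> K"
  using assms(3,4)
\<comment> \<open>Here \<open>m\<close> is a threshold: edges between different fibers have weight
  at most \<open>m\<close>, and each fiber is connected by edges of weight at least
  \<open>m\<close>. Contracting a heaviest remaining edge lowers the threshold to its weight and
  preserves both properties.\<close>
proof (induction "card (f ` V)" arbitrary: f m rule: less_induct)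
  case less
  show ?case
  proof (cases "\<exists>x y. {x, y} \<in> E \<and> f x \<noteq> f y")
    case False
    then have "contraction_sequence (quotient_graph V E f) []"
      unfolding contraction_sequence_Nil_quotient[OF G] by blast
    then show ?thesis by (intro exI[of _ "[]"]) simp
  next
    case True
    define P where "P p \<longleftrightarrow> {fst p, snd p} \<in> E \<and> f (fst p) \<noteq> f (snd p)" for p
    obtain p0 where "P p0" using True by (auto simp: P_def)
    moreover have "\<forall>p. P p \<longrightarrow> min (w (fst p)) (w (snd p)) < Suc m"
      using less.prems(1) by (simp add: P_def less_Suc_eq_le)
    ultimately obtain p where p: "P p"
      and max: "\<forall>q. P q \<longrightarrow> min (w (fst q)) (w (snd q)) \<le> min (w (fst p)) (w (snd p))"
      using ex_has_greatest_nat[of P p0 "\<lambda>p. min (w (fst p)) (w (snd p))" "Suc m"] by blast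
    define x y where "x = fst p" "y = snd p"
    have xy: "{x, y} \<in> E" "f x \<noteq> f y" using p by (auto simp: x_y_def P_def)
    note xyV = simple_graph_edgeD[OF G xy(1)]
    define m' where "m' = min (w x) (w y)"
    define g where "g = id(f y := f x) \<circ> f"
    define R where "R = edge_rel {e \<in> E. \<forall>z\<in>e. m' \<le> w z}"
    have "m' \<le> m" using less.prems(1)[OF xy] by (simp add: m'_def)
    have g1: "min (w a) (w b) \<le> m'" if "{a, b} \<in> E" "g a \<noteq> g b" for a b
    proof -
      have "f a \<noteq> f b" using that(2) unfolding g_def comp_apply by metis
      then have "P (a, b)" using that(1) by (simp add: P_def)
      then show ?thesis using max[rule_format, of "(a, b)"] by (simp add: m'_def x_y_def)
    qed
    have f2: "(a, b) \<in> R\<^sup>*" if "a \<in> V" "b \<in> V" "f a = f b" for a b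
    proof -
      have "edge_rel {e \<in> E. \<forall>z\<in>e. m \<le> w z} \<subseteq> R"
        using \<open>m' \<le> m\<close> by (auto simp: R_def edge_rel_def)
      then show ?thesis using less.prems(2)[OF that] rtrancl_mono by blast
    qed
    have "(x, y) \<in> R" "(y, x) \<in> R"
      using xy(1) by (auto simp: R_def edge_rel_def m'_def insert_commute)
    \<comment> \<open>Inside the merged fiber, the two old fibers are joined through the edge from
      \<open>x\<close> to \<open>y\<close>, whose weight is exactly \<open>m'\<close>.\<close>
    then have g2: "(a, b) \<in> R\<^sup>*" if ab: "a \<in> V" "b \<in> V" "g a = g b" for a b
    proof -
      consider "f a = f b" | "f a = f x" "f b = f y" | "f a = f y" "f b = f x"
        using ab(3) unfolding g_def comp_apply fun_upd_apply id_apply by metis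
      then show ?thesis
      proof cases
        case 1
        then show ?thesis using f2 ab by blast
      next
        case 2
        then have "(a, x) \<in> R\<^sup>*" "(y, b) \<in> R\<^sup>*" using f2 ab xyV by auto
        then show ?thesis using \<open>(x, y) \<in> R\<close> by (meson rtrancl.rtrancl_into_rtrancl rtrancl_trans)
      next
        case 3
        then have "(a, y) \<in> R\<^sup>*" "(x, b) \<in> R\<^sup>*" using f2 ab xyV by auto
        then show ?thesis using \<open>(y, x) \<in> R\<close> by (meson rtrancl.rtrancl_into_rtrancl rtrancl_trans)
      qed
    qed
    define X where "X = fiber V g (f x)"
    have "x \<in> X" "y \<in> X" using xyV xy by (auto simp: X_def g_def fiber_def)
    have "card (edge_cut E X) \<le> K"
    proof (rule bound)
      show "X \<subseteq> V" by (auto simp: X_def fiber_def)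
      \<comment> \<open>The witness is the lighter end of the contracted edge.\<close>
      show "\<exists>v\<in>X. w v = m'" using \<open>x \<in> X\<close> \<open>y \<in> X\<close> by (auto simp: m'_def min_def)
      show "(a, b) \<in> (edge_rel {e \<in> E. \<forall>z\<in>e. m' \<le> w z})\<^sup>*" if "a \<in> X" "b \<in> X" for a b
        using g2[of a b] that unfolding R_def by (simp add: X_def fiber_def)
      show "\<exists>z\<in>e. w z \<le> m'" if "e \<in> edge_cut E X" for e
      proof -
        have "e \<in> E" using that by (simp add: edge_cut_def)
        then obtain a b where ab: "e = {a, b}" "a \<noteq> b" "a \<in> V" "b \<in> V"
          by (rule simple_graph_edgeE[OF G])
        then have "(a \<in> X) \<noteq> (b \<in> X)"
          using that edge_in_cut_iff[of a b E X] \<open>e \<in> E\<close> by simp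
        then have "g a \<noteq> g b" using ab by (auto simp: X_def fiber_def)
        then have "min (w a) (w b) \<le> m'" using g1 ab \<open>e \<in> E\<close> by simp
        then show ?thesis using ab by (auto simp: min_def split: if_splits)
      qed
    qed
    moreover have con: "contract (f x) (f y) (quotient_graph V E f) = quotient_graph V E g"
      unfolding g_def using xy xyV by (intro contract_quotient_graph[OF G]) auto
    moreover have "g ` V = f ` V - {f y}"
      using con by (simp add: contract_def quotient_graph_def)
    then have "card (g ` V) < card (f ` V)"
      using G xyV card_Diff1_less[of "f ` V" "f y"] by (simp add: simple_graph_def)
    then obtain ps where "contraction_sequence (quotient_graph V E g) ps"
      "sequence_complexity (quotient_graph V E g) ps \<le> K"
      using less.hyps[of g m'] g1 g2 unfolding R_def by blast
    moreover have "{f x, f y} \<in># snd (quotient_graph V E f)"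
      using quotient_graph_edge_iff[OF G, of "f x" "f y" f] xy by blast
    ultimately show ?thesis using xy
      by (intro exI[of _ "(f x, f y) # ps"]) (simp add: multidegree_quotient_graph[OF G] X_def)
  qed
qed

section \<open>Rooting a tree\<close>

lemma rtrancl_edge_rel_distinct_walk:
  assumes "(a, b) \<in> (edge_rel {e \<in> A. e \<subseteq> M})\<^sup>*" "a \<in> M"
  shows "\<exists>p. p \<noteq> [] \<and> hd p = a \<and> last p = b \<and> distinct p
    \<and> successively (\<lambda>x y. {x, y} \<in> A) p \<and> set p \<subseteq> M"
  using assms(1)
proof (induction rule: rtrancl_induct)
  case base
  then show ?case using assms(2) by (intro exI[of _ "[a]"]) auto
next
  case (step y z)
  then obtain p where p: "p \<noteq> []" "hd p = a" "last p = y" "distinct p"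
    "successively (\<lambda>x y. {x, y} \<in> A) p" "set p \<subseteq> M" by blast
  have yz: "{y, z} \<in> A" "z \<in> M" using step(2) by (auto simp: edge_rel_def)
  show ?case
  proof (cases "z \<in> set p")
    case True
    \<comment> \<open>A walk returning to a visited vertex is truncated there, which keeps it
      distinct.\<close>
    then obtain q r where "p = q @ z # r" by (meson split_list)
    then show ?thesis using p
      by (intro exI[of _ "q @ [z]"]) (auto simp: successively_append_iff hd_append)
  next
    case False
    then show ?thesis using p yz
      by (intro exI[of _ "p @ [z]"]) (auto simp: successively_append_iff)
  qed
qed

lemma rtrancl_leaves_set:
  assumes "(a, b) \<in> R\<^sup>*" "a \<in> M" "b \<notin> M"
  shows "\<exists>c d. (c, d) \<in> R \<and> c \<in> M \<and> d \<notin> M"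
  using assms by (induction rule: rtrancl_induct) auto

text \<open>Two different neighbours of \<open>x\<close> in the connected part \<open>M\<close>
  would be joined by a path inside \<open>M\<close>, which \<open>x\<close> closes to a
  cycle.\<close>

lemma graph_tree_unique_attachment:
  assumes "graph_tree N A" "M \<subseteq> N" "x \<notin> M" "a \<in> M" "b \<in> M" "{a, x} \<in> A" "{b, x} \<in> A"
    and "(a, b) \<in> (edge_rel {e \<in> A. e \<subseteq> M})\<^sup>*"
  shows "a = b"
proof (rule ccontr)
  assume "a \<noteq> b"
  obtain p where p: "p \<noteq> []" "hd p = a" "last p = b" "distinct p"
    "successively (\<lambda>x y. {x, y} \<in> A) p" "set p \<subseteq> M"
    using rtrancl_edge_rel_distinct_walk[OF assms(8,4)] by blast
  have "length p \<noteq> 1" using p \<open>a \<noteq> b\<close> by (auto simp: length_Suc_conv)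
  then have "length p \<ge> 2" using p(1) by (cases p) (auto simp: Suc_le_eq)
  then have "graph_cycle A (p @ [x])"
    using p assms by (auto simp: graph_cycle_def successively_append_iff insert_commute)
  then show False using assms(1) by (auto simp: graph_tree_def)
qed

text \<open>The tree is grown from one vertex by attaching neighbours. A new vertex has a single
  neighbour in the part already built, which becomes its parent; its rank is the time of its
  arrival.\<close>

lemma graph_tree_parent_function:
  assumes "graph_tree N A"
  obtains \<rho> :: "'b \<Rightarrow> nat" and par
    where "\<And>e. e \<in> A \<Longrightarrow> \<exists>t\<in>N. e = {t, par t} \<and> \<rho> (par t) < \<rho> t"
proof -
  have N: "simple_graph N A" "graph_connected N A" "finite N" "N \<noteq> {}"
    using assms by (auto simp: graph_tree_def simple_graph_def graph_connected_def)
  have grow: "\<exists>M \<rho> par. M \<subseteq> N \<and> card M = Suc k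
      \<and> (\<forall>x\<in>M. \<forall>y\<in>M. (x, y) \<in> (edge_rel {e \<in> A. e \<subseteq> M})\<^sup>*) \<and> (\<forall>t\<in>M. \<rho> t < Suc k)
      \<and> (\<forall>e\<in>A. e \<subseteq> M \<longrightarrow> (\<exists>t\<in>M. e = {t, par t} \<and> \<rho> (par t) < (\<rho> t :: nat)))"
    if "Suc k \<le> card N" for k
    using that
  proof (induction k)
    case 0
    obtain r where r: "r \<in> N" using N by blast
    have "\<not> e \<subseteq> {r}" if "e \<in> A" for e
      using N(1) that card_mono[of "{r}" e] by (auto simp: simple_graph_def)
    then show ?case using r by (intro exI[of _ "{r}"] exI[of _ "\<lambda>_. 0"] exI[of _ id]) auto
  next
    case (Suc k)
    then have "Suc k \<le> card N" by simp
    then obtain M \<rho> par where M: "M \<subseteq> N" "card M = Suc k"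
      and *: "\<forall>x\<in>M. \<forall>y\<in>M. (x, y) \<in> (edge_rel {e \<in> A. e \<subseteq> M})\<^sup>*" "\<forall>t\<in>M. \<rho> t < Suc k"
        "\<forall>e\<in>A. e \<subseteq> M \<longrightarrow> (\<exists>t\<in>M. e = {t, par t} \<and> \<rho> (par t) < (\<rho> t :: nat))"
      using Suc.IH by (elim meta_impE exE conjE) (assumption, rule that)
    note conn = *(1)[rule_format] and \<rho> = *(2)[rule_format] and par = *(3)[rule_format]
    have "finite M" using M(1) N(3) by (rule finite_subset)
    have "M \<noteq> {}" "M \<noteq> N" using M(2) Suc.prems by auto
    then obtain a0 x0 where "a0 \<in> M" "x0 \<in> N" "x0 \<notin> M" using M(1) by blast
    then have "(a0, x0) \<in> (edge_rel A)\<^sup>*" using N(2) M(1) by (auto simp: graph_connected_def)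
    then obtain a x where ax: "{a, x} \<in> A" "a \<in> M" "x \<notin> M"
      using rtrancl_leaves_set[of a0 x0 "edge_rel A" M] \<open>a0 \<in> M\<close> \<open>x0 \<notin> M\<close>
      by (auto simp: edge_rel_def)
    have "x \<in> N" using simple_graph_edgeD[OF N(1) ax(1)] by simp
    \<comment> \<open>All ranks so far are below \<open>Suc k\<close>, so the new vertex ranks above
      its parent.\<close>
    let ?M = "insert x M" and ?\<rho> = "\<rho>(x := Suc k)" and ?par = "par(x := a)"
    let ?R = "edge_rel {e \<in> A. e \<subseteq> ?M}"
    have "edge_rel {e \<in> A. e \<subseteq> M} \<subseteq> ?R" by (auto simp: edge_rel_def)
    then have R: "(s, t) \<in> ?R\<^sup>*" if "s \<in> M" "t \<in> M" for s t
      using conn[OF that] rtrancl_mono by blast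
    have ax': "(a, x) \<in> ?R" "(x, a) \<in> ?R" using ax by (auto simp: edge_rel_def insert_commute)
    have "(a, t) \<in> ?R\<^sup>* \<and> (t, a) \<in> ?R\<^sup>*" if "t \<in> ?M" for t
      using that R ax(2) ax' by blast
    then have "\<forall>s\<in>?M. \<forall>t\<in>?M. (s, t) \<in> ?R\<^sup>*" by (meson rtrancl_trans)
    moreover have "\<exists>t\<in>?M. e = {t, ?par t} \<and> ?\<rho> (?par t) < ?\<rho> t" if e: "e \<in> A" "e \<subseteq> ?M" for e
    proof (cases "x \<in> e")
      case True
      obtain b where b: "e = {b, x}" "b \<noteq> x"
        using simple_graph_edgeE[OF N(1) e(1)] True by (metis doubleton_eq_iff insertE insert_commute singletonD)
      then have "b \<in> M" using e by auto
      then have "a = b"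
        using graph_tree_unique_attachment[OF assms M(1) ax(3) ax(2) _ ax(1)] b e conn ax(2) by auto
      then show ?thesis using b \<rho>[OF ax(2)] by (intro bexI[of _ x]) auto
    next
      case False
      then obtain t where t: "t \<in> M" "e = {t, par t}" "\<rho> (par t) < \<rho> t" using par[of e] e by auto
      then have "t \<noteq> x" "par t \<noteq> x" using False by auto
      then show ?thesis using t by (intro bexI[of _ t]) auto
    qed
    moreover have "?M \<subseteq> N" "card ?M = Suc (Suc k)"
      using M \<open>x \<in> N\<close> ax \<open>finite M\<close> by auto
    moreover have "\<forall>t\<in>?M. ?\<rho> t < Suc (Suc k)" by (auto dest: \<rho>)
    ultimately show ?case by (intro exI[of _ ?M] exI[of _ ?\<rho>] exI[of _ ?par] conjI) blast+
  qed
  have "Suc (card N - 1) = card N" using N(3,4) by (simp add: card_gt_0_iff)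
  then obtain M \<rho> par where *: "M \<subseteq> N" "card M = card N"
    "\<forall>e\<in>A. e \<subseteq> M \<longrightarrow> (\<exists>t\<in>M. e = {t, par t} \<and> \<rho> (par t) < (\<rho> t :: nat))"
    using grow[of "card N - 1"] by (elim meta_impE exE conjE) (simp, rule that, simp_all)
  have "M = N" using N(3) *(1,2) by (rule card_subset_eq)
  show thesis
  proof (rule that)
    fix e assume "e \<in> A"
    moreover from this have "e \<subseteq> N" using N(1) by (simp add: simple_graph_def)
    ultimately show "\<exists>t\<in>N. e = {t, par t} \<and> \<rho> (par t) < \<rho> t"
      using *(3) unfolding \<open>M = N\<close> by blast
  qed
qed

section \<open>Top bags and cuts in a rooted tree decomposition\<close>

text \<open>\<open>(s, t) \<in> R\<^sup>*\<close> says that \<open>t\<close> is an ancestor of \<open>s\<close>.\<close>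

context
  fixes V :: "'a set" and E :: "'a set set" and N :: "'b set" and A :: "'b set set"
    and B :: "'b \<Rightarrow> 'a set" and \<rho> :: "'b \<Rightarrow> nat" and par :: "'b \<Rightarrow> 'b" and top :: "'a \<Rightarrow> 'b"
    and R :: "('b \<times> 'b) set"
  assumes G: "simple_graph V E"
    and dec: "tree_decomposition V E N A B"
    and par: "\<And>e. e \<in> A \<Longrightarrow> \<exists>t\<in>N. e = {t, par t} \<and> \<rho> (par t) < \<rho> t"
    and top: "\<And>v. v \<in> V \<Longrightarrow> top v \<in> N \<and> v \<in> B (top v)"
    and top_le: "\<And>v t. \<lbrakk>v \<in> V; t \<in> N; v \<in> B t\<rbrakk> \<Longrightarrow> \<rho> (top v) \<le> \<rho> t"
    and R_eq: "R = {(t, par t) | t. \<rho> (par t) < \<rho> t}"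
begin

text \<open>\<open>R\<close> keeps only those pairs along which the rank drops, so arbitrary values
  of \<open>par\<close> at the root create no cycles.\<close>

lemma ancestor_rank: "(s, t) \<in> R\<^sup>* \<Longrightarrow> s = t \<or> \<rho> t < \<rho> s"
  by (induction rule: rtrancl_induct) (auto simp: R_eq)

lemma ancestors_linear:
  assumes "(b, s) \<in> R\<^sup>*" "(b, t) \<in> R\<^sup>*" "\<rho> s \<le> \<rho> t"
  shows "(t, s) \<in> R\<^sup>*"
proof -
  have "single_valued R" by (auto simp: R_eq single_valued_def)
  then have "(t, s) \<in> R\<^sup>* \<or> (s, t) \<in> R\<^sup>*" using single_valued_confluent assms(1,2) by metis
  then show ?thesis using ancestor_rank[of s t] assms(3) by auto
qed

text \<open>Follow a path from the top bag through nodes whose bags contain \<open>v\<close>. A move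
  to a child lengthens the chain of ancestors by one such node; a move to a parent shortens
  it.\<close>

lemma bag_below_top:
  assumes v: "v \<in> V" and t: "t \<in> N" "v \<in> B t"
  shows "(t, top v) \<in> R\<^sup>* \<and> (\<forall>s. (t, s) \<in> R\<^sup>* \<and> (s, top v) \<in> R\<^sup>* \<longrightarrow> v \<in> B s)"
proof -
  let ?T = "{t \<in> N. v \<in> B t}"
  have "(top v, t) \<in> (edge_rel {a \<in> A. a \<subseteq> ?T})\<^sup>*"
    using dec v t top[OF v] by (auto simp: tree_decomposition_def graph_connected_def)
  then show ?thesis
  proof (induction rule: rtrancl_induct)
    case base
    have "s = top v" if "(top v, s) \<in> R\<^sup>*" "(s, top v) \<in> R\<^sup>*" for s
      using ancestor_rank[OF that(1)] ancestor_rank[OF that(2)] by auto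
    then show ?case using top[OF v] by auto
  next
    case (step y z)
    then have yz: "{y, z} \<in> A" "z \<in> N" "v \<in> B z" by (auto simp: edge_rel_def)
    then obtain c where c: "{y, z} = {c, par c}" "\<rho> (par c) < \<rho> c" using par by blast
    then have cR: "(c, par c) \<in> R" by (auto simp: R_eq)
    have up: "s = c \<or> (par c, s) \<in> R\<^sup>*" if "(c, s) \<in> R\<^sup>*" for s
      using that by (cases rule: converse_rtranclE) (auto simp: R_eq)
    from c(1) consider "y = par c" "z = c" | "y = c" "z = par c" by (auto simp: doubleton_eq_iff)
    then show ?case
    proof cases
      case 1
      then have "(z, top v) \<in> R\<^sup>*" using step.IH cR by (meson converse_rtrancl_into_rtrancl)
      moreover have "v \<in> B s" if "(z, s) \<in> R\<^sup>*" "(s, top v) \<in> R\<^sup>*" for s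
        using up[of s] that 1 yz(3) step.IH by auto
      ultimately show ?thesis by blast
    next
      case 2
      \<comment> \<open>The path cannot climb above the top bag: the parent would contain
        \<open>v\<close> at a smaller rank.\<close>
      have "c \<noteq> top v" using top_le[OF v yz(2,3)] c(2) 2 by auto
      then have "(z, top v) \<in> R\<^sup>*" using up[of "top v"] step.IH 2 by auto
      moreover have "v \<in> B s" if "(z, s) \<in> R\<^sup>*" "(s, top v) \<in> R\<^sup>*" for s
        using that step.IH 2 cR by (meson converse_rtrancl_into_rtrancl)
      ultimately show ?thesis by blast
    qed
  qed
qed

lemma edge_in_bag:
  assumes "{x, y} \<in> E"
  obtains b where "b \<in> N" "x \<in> B b" "y \<in> B b"
  using assms dec by (auto simp: tree_decomposition_def)

lemma cut_meets_bag:
  assumes X: "X \<subseteq> V" and v: "v \<in> X"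
    and conn: "\<And>x. x \<in> X \<Longrightarrow> (v, x) \<in> (edge_rel {e \<in> E. \<forall>z\<in>e. \<rho> (top v) \<le> \<rho> (top z)})\<^sup>*"
    and e: "e \<in> edge_cut E X" and z: "z \<in> e" "\<rho> (top z) \<le> \<rho> (top v)"
  shows "e \<inter> B (top v) \<noteq> {}"
proof -
  \<comment> \<open>Along an edge, both top bags are ancestors of a common bag \<open>b\<close>, and
    so is \<open>top v\<close> by induction. As \<open>top y\<close> ranks no lower than
    \<open>top v\<close>, it lies below it.\<close>
  have below: "(top x, top v) \<in> R\<^sup>*" if "x \<in> X" for x
    using conn[OF that]
  proof (induction rule: rtrancl_induct)
    case (step x y)
    then have xy: "{x, y} \<in> E" "\<rho> (top v) \<le> \<rho> (top y)" by (auto simp: edge_rel_def)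
    note xyV = simple_graph_edgeD[OF G xy(1)]
    obtain b where b: "b \<in> N" "x \<in> B b" "y \<in> B b" by (rule edge_in_bag[OF xy(1)])
    then have "(b, top x) \<in> R\<^sup>*" "(b, top y) \<in> R\<^sup>*" using bag_below_top xyV by blast+
    then show ?case using step.IH xy(2) by (meson ancestors_linear rtrancl_trans)
  qed simp
  have "e \<in> E" using e by (simp add: edge_cut_def)
  then obtain x y where "e = {x, y}" "x \<in> X" "y \<notin> X"
  proof -
    obtain a b where ab: "e = {a, b}" "a \<noteq> b" by (rule simple_graph_edgeE[OF G \<open>e \<in> E\<close>])
    then have "(a \<in> X) \<noteq> (b \<in> X)" using e edge_in_cut_iff[of a b E X] \<open>e \<in> E\<close> by simp
    then show thesis using that[of a b] that[of b a] ab by auto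
  qed
  note xy = this
  have xyV: "x \<in> V" "y \<in> V" using simple_graph_edgeD[OF G, of x y] \<open>e \<in> E\<close> xy by auto
  show ?thesis
  proof (cases "z = x")
    \<comment> \<open>The inner end has its top bag both below \<open>top v\<close> and of no larger
      rank, so the two coincide.\<close>
    case True
    then have "top x = top v" using below[OF xy(2)] ancestor_rank[of "top x" "top v"] z(2) by auto
    then show ?thesis using top[OF xyV(1)] xy by auto
  next
    case False
    then have "z = y" using z xy by auto
    obtain b where b: "b \<in> N" "x \<in> B b" "y \<in> B b"
      using edge_in_bag[of x y] \<open>e \<in> E\<close> xy(1) by auto
    \<comment> \<open>For the outer end, \<open>top v\<close> lies on the chain from the common bag
      \<open>b\<close> up to \<open>top y\<close>, and all bags on that chain contain
      \<open>y\<close>.\<close>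
    have bv: "(b, top v) \<in> R\<^sup>*"
      using bag_below_top[OF xyV(1) b(1,2)] below[OF xy(2)] by (meson rtrancl_trans)
    note by_top = bag_below_top[OF xyV(2) b(1,3)]
    have "(top v, top y) \<in> R\<^sup>*"
      using by_top[THEN conjunct1] bv z(2)[unfolded \<open>z = y\<close>] by (rule ancestors_linear)
    then have "y \<in> B (top v)"
      using by_top[THEN conjunct2, rule_format, of "top v"] bv by simp
    then show ?thesis using xy by auto
  qed
qed

end

section \<open>Counting cut edges and the treewidth bound\<close>

lemma card_edges_meeting_le:
  assumes G: "simple_graph V E" and "U \<subseteq> V" and F: "\<And>e. e \<in> F \<Longrightarrow> e \<in> E \<and> e \<inter> U \<noteq> {}"
  shows "card F \<le> card U * max_degree V E"
proof -
  have fin: "finite V" "finite U" "finite E"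
    using G assms(2) simple_graph_finite_edges[OF G] by (auto simp: simple_graph_def finite_subset)
  have "F \<subseteq> (\<Union>u\<in>U. {e \<in> E. u \<in> e})" using F by blast
  then have "card F \<le> card (\<Union>u\<in>U. {e \<in> E. u \<in> e})" using fin by (intro card_mono) auto
  also have "\<dots> \<le> (\<Sum>u\<in>U. vertex_degree E u)"
    unfolding vertex_degree_def using fin(2) by (rule card_UN_le)
  also have "\<dots> \<le> (\<Sum>u\<in>U. max_degree V E)"
    unfolding max_degree_def using fin assms(2) by (intro sum_mono Max_ge) auto
  finally show ?thesis by simp
qed

lemma contraction_complexity_le_decomposition_width:
  assumes G: "simple_graph V E" and dec: "tree_decomposition V E N A B"
  shows "contraction_complexity V E \<le> max_degree V E * (decomposition_width N B + 1)"
proof -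
  have tree: "graph_tree N A" and bags: "(\<Union>t\<in>N. B t) = V"
    using dec by (auto simp: tree_decomposition_def)
  obtain \<rho> :: "'b \<Rightarrow> nat" and par
    where par: "\<And>e. e \<in> A \<Longrightarrow> \<exists>t\<in>N. e = {t, par t} \<and> \<rho> (par t) < \<rho> t"
    using graph_tree_parent_function[OF tree] by blast
  have "\<exists>t. (t \<in> N \<and> v \<in> B t) \<and> (\<forall>s. s \<in> N \<and> v \<in> B s \<longrightarrow> \<rho> t \<le> \<rho> s)" if v: "v \<in> V" for v
  proof -
    obtain t where "t \<in> N \<and> v \<in> B t" using v bags by blast
    then show ?thesis by (rule ex_has_least_nat)
  qed
  then obtain top where top: "\<And>v. v \<in> V \<Longrightarrow> top v \<in> N \<and> v \<in> B (top v)"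
    and top_le: "\<And>v t. \<lbrakk>v \<in> V; t \<in> N; v \<in> B t\<rbrakk> \<Longrightarrow> \<rho> (top v) \<le> \<rho> t"
    by metis
  define K where "K = max_degree V E * (decomposition_width N B + 1)"
  define w where "w v = \<rho> (top v)" for v
  have fin: "finite N" "finite V"
    using tree G by (auto simp: graph_tree_def simple_graph_def)
  have "\<exists>ps. contraction_sequence (quotient_graph V E id) ps
      \<and> sequence_complexity (quotient_graph V E id) ps \<le> K"
  \<comment> \<open>The maximal weight is a valid initial threshold: no edge exceeds it, and the
    fibers of \<open>id\<close> are trivially connected.\<close>
  proof (rule greedy_contraction_sequence[OF G, where w = w and m = "Max (w ` V)"])
    fix X m
    assume X: "X \<subseteq> V" "\<exists>v\<in>X. w v = m"
      and conn: "\<And>x y. \<lbrakk>x \<in> X; y \<in> X\<rbrakk> \<Longrightarrow> (x, y) \<in> (edge_rel {e \<in> E. \<forall>z\<in>e. m \<le> w z})\<^sup>*"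
      and cut: "\<And>e. e \<in> edge_cut E X \<Longrightarrow> \<exists>z\<in>e. w z \<le> m"
    obtain v where v: "v \<in> X" "w v = m" using X(2) by blast
    have meets: "e \<in> E \<and> e \<inter> B (top v) \<noteq> {}" if e: "e \<in> edge_cut E X" for e
    proof -
      obtain z where z: "z \<in> e" "\<rho> (top z) \<le> \<rho> (top v)"
        using cut[OF e] v(2) by (auto simp: w_def)
      have "(v, x) \<in> (edge_rel {e \<in> E. \<forall>z\<in>e. \<rho> (top v) \<le> \<rho> (top z)})\<^sup>*" if "x \<in> X" for x
        using conn[OF v(1) that] unfolding v(2)[symmetric] w_def .
      then have "e \<inter> B (top v) \<noteq> {}"
        by (intro cut_meets_bag[OF G dec par top top_le refl X(1) v(1) _ e z])
      then show ?thesis using e by (simp add: edge_cut_def)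
    qed
    have t: "top v \<in> N" "B (top v) \<subseteq> V" using v X(1) top bags by auto
    have "card (B (top v)) \<le> Max ((\<lambda>t. card (B t)) ` N)"
      using fin(1) t(1) by (intro Max_ge) auto
    \<comment> \<open>Truncated subtraction is harmless here, since adding 1 back can only overshoot
      the maximum.\<close>
    then have width: "card (B (top v)) \<le> decomposition_width N B + 1"
      by (simp add: decomposition_width_def)
    have "card (edge_cut E X) \<le> card (B (top v)) * max_degree V E"
      using G t(2) meets by (rule card_edges_meeting_le)
    also have "\<dots> \<le> (decomposition_width N B + 1) * max_degree V E"
      using width by (rule mult_le_mono1)
    also have "\<dots> = K" by (simp add: K_def)
    finally show "card (edge_cut E X) \<le> K" .
  next
    fix x y assume "{x, y} \<in> E"
    then have "w x \<le> Max (w ` V)"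
      using simple_graph_edgeD[OF G] fin(2) by (intro Max_ge) auto
    then show "min (w x) (w y) \<le> Max (w ` V)" by simp
  qed simp
  then obtain ps where "contraction_sequence (V, mset_set E) ps"
    "sequence_complexity (V, mset_set E) ps \<le> K"
    unfolding quotient_graph_id[OF G] by blast
  moreover from this(1) have "contraction_complexity V E \<le> sequence_complexity (V, mset_set E) ps"
    unfolding contraction_complexity_def by (intro cInf_lower) auto
  ultimately show ?thesis unfolding K_def by linarith
qed

lemma contraction_complexity_le_treewidth:
  assumes "simple_graph V E"
  shows "contraction_complexity V E \<le> max_degree V E * (treewidth V E + 1)"
proof -
  let ?W = "{decomposition_width N B | (N :: nat set) A B. tree_decomposition V E N A B}"
  have "?W \<noteq> {}" using tree_decomposition_exists[OF assms] by blast
  then have "Inf ?W \<in> ?W" by (rule Inf_nat_def1)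
  then obtain N :: "nat set" and A B
    where "tree_decomposition V E N A B" "treewidth V E = decomposition_width N B"
    by (auto simp: treewidth_def)
  then show ?thesis using contraction_complexity_le_decomposition_width[OF assms] by metis
qed

text \<open>Together with \<open>treewidth V E + 1\<close> being positive, this lets the final bound
  absorb the 1 in \<open>max 1\<close>.\<close>

lemma max_degree_pos:
  assumes G: "simple_graph V E" "graph_connected V E" and "2 \<le> card V"
  shows "1 \<le> max_degree V E"
proof -
  have fin: "finite V" "finite E"
    using G simple_graph_finite_edges by (auto simp: simple_graph_def)
  obtain x y where xy: "x \<in> V" "y \<in> V" "x \<noteq> y"
    using card_le_Suc0_iff_eq[OF fin(1)] assms(3) by auto
  then have "(x, y) \<in> (edge_rel E)\<^sup>*" using G(2) by (simp add: graph_connected_def)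
  then obtain z where "{x, z} \<in> E"
    using xy(3) by (cases rule: converse_rtranclE) (auto simp: edge_rel_def)
  then have "1 \<le> vertex_degree E x"
    using fin(2) by (auto simp: vertex_degree_def Suc_le_eq card_gt_0_iff)
  also have "\<dots> \<le> max_degree V E"
    unfolding max_degree_def using fin(1) xy(1) by (intro Max_ge) auto
  finally show ?thesis .
qed

theorem corollary4p35:
  fixes V :: "'a set" and E :: "'a set set" and n C d chi :: nat
  assumes "simple_graph V E"
    and "graph_connected V E"
    and "n = card V" and "n \<ge> 2"
    and "C = contraction_complexity V E"
    and "d \<ge> 2" and "chi \<ge> 1"
  shows "int (learning_complexity d chi V E)
           \<le> min (int n) (3 * max 1 \<lceil>real C * log (real d) (real chi)\<rceil>)
       \<and> min (int n) (3 * max 1 \<lceil>real C * log (real d) (real chi)\<rceil>)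
           \<le> 3 * int (max_degree V E) * (int (treewidth V E) + 1)
               * max 1 \<lceil>log (real d) (real chi)\<rceil>"
proof
  define l where "l = log (real d) (real chi)"
  have l: "0 \<le> l" using assms(6,7) by (simp add: l_def)
  have card: "2 \<le> card V" using assms(3,4) by simp
  then have "V \<noteq> {}" by auto
  have "learning_complexity d chi V E \<le> n"
    using learning_complexity_le_card[OF \<open>V \<noteq> {}\<close> assms(1)] assms(3) by simp
  moreover have "learning_complexity d chi V E \<le> 3 * max 1 (nat \<lceil>real C * l\<rceil>)"
    using learning_complexity_le_contraction_complexity[OF assms(1,2) card assms(6,7)]
    unfolding l_def assms(5) .
  then have "int (learning_complexity d chi V E) \<le> 3 * max 1 \<lceil>real C * l\<rceil>" by linarith
  ultimately show "int (learning_complexity d chi V E)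
      \<le> min (int n) (3 * max 1 \<lceil>real C * log (real d) (real chi)\<rceil>)"
    unfolding l_def by simp
  define D where "D = int (max_degree V E) * (int (treewidth V E) + 1)"
  have "1 \<le> max_degree V E * (treewidth V E + 1)"
    using max_degree_pos[OF assms(1,2) card] by simp
  then have D1: "1 \<le> D" unfolding D_def by (metis of_nat_1 of_nat_add of_nat_le_iff of_nat_mult)
  have "C \<le> max_degree V E * (treewidth V E + 1)"
    using contraction_complexity_le_treewidth[OF assms(1)] assms(5) by simp
  then have CD: "int C \<le> D" unfolding D_def by (metis of_nat_1 of_nat_add of_nat_le_iff of_nat_mult)
  let ?M = "max 1 \<lceil>l\<rceil>"
  have "real C * l \<le> real C * real_of_int ?M" by (intro mult_left_mono) linarith+
  \<comment> \<open>The right-hand side is an integer, so bounding the real product also bounds its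
    ceiling.\<close>
  then have "\<lceil>real C * l\<rceil> \<le> int C * ?M" by (simp add: ceiling_le_iff)
  also have "\<dots> \<le> D * ?M" using CD by (intro mult_right_mono) auto
  finally have "\<lceil>real C * l\<rceil> \<le> D * ?M" .
  moreover have "1 \<le> D * ?M" using mult_mono[of 1 D 1 ?M] D1 by simp
  ultimately have "3 * max 1 \<lceil>real C * l\<rceil> \<le> 3 * (D * ?M)" by simp
  then show "min (int n) (3 * max 1 \<lceil>real C * log (real d) (real chi)\<rceil>)
      \<le> 3 * int (max_degree V E) * (int (treewidth V E) + 1) * max 1 \<lceil>log (real d) (real chi)\<rceil>"
    unfolding l_def D_def by (simp add: mult.assoc min.coboundedI2)
qed

end
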